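(* Let $A,B,K\in\mathbb{R}^{2\times2}$ with $B$ invertible and $\tilde A:=A-BK$ Hurwitz, let $G(\mathbf{x})=B^\top B$, and let $h(\mathbf{x})=\|\mathbf{x}-\mathbf{x}_c\|^2-r^2$ with $\mathbf{x}_c\in\mathbb{R}^2$, $r>0$ and $h(\mathbf{0}_2)>0$. Suppose $\mathbf{x}_c$ is not an eigenvector of $\tilde A$. Then, for the filtered system $\dot{\mathbf{x}}=\tilde A\mathbf{x}+Bv(\mathbf{x})$, $1\le|\hat{\mathcal{E}}|\le3$ and $|\mathcal{E}\setminus\hat{\mathcal{E}}|\ge1$. In addition, if the eigenvalues $\lambda_1,\lambda_2$ of $\tilde A$ are real with $\lambda_1\le\lambda_2$, there exists $\mathbf{x}_*\in\hat{\mathcal{E}}$ with indicator $\delta<\frac{\lambda_1}{2}$.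
   Context: The nominal controller for $\dot{\mathbf{x}}=A\mathbf{x}+B\mathbf{u}$ is $\mathbf{u}=-K\mathbf{x}$, and the safe set is $\mathcal{C}=\{h\ge0\}$. $\alpha:\mathbb{R}\to\mathbb{R}$ is an extended class $\mathcal{K}_\infty$ function (continuous, strictly increasing, $\alpha(0)=0$, $\lim_{s\to\pm\infty}\alpha(s)=\pm\infty$). With $\eta(\mathbf{x})=\nabla h(\mathbf{x})^\top\tilde A\mathbf{x}+\alpha(h(\mathbf{x}))$, the safety filter is $v(\mathbf{x})=\mathbf{0}$ if $\eta(\mathbf{x})\ge0$ and $v(\mathbf{x})=-\dfrac{\eta(\mathbf{x})G(\mathbf{x})^{-1}B^\top\nabla h(\mathbf{x})}{\nabla h(\mathbf{x})^\top BG(\mathbf{x})^{-1}B^\top\nabla h(\mathbf{x})}$ if $\eta(\mathbf{x})<0$. The set of potential undesired equilibria is $\mathcal{E}=\{\mathbf{x}:\ h(\mathbf{x})=0,\ \exists\,\delta\in\mathbb{R}\text{ with }\tilde A\mathbf{x}=\delta BG(\mathbf{x})^{-1}B^\top\nabla h(\mathbf{x})\}$; the set of undesired equilibria $\hat{\mathcal{E}}$ is defined in the same way but requiring $\delta<0$ (it equals the set of equilibria of the filtered system in $\mathcal{C}$ other than the origin). For $\mathbf{x}_*$ in these sets, the corresponding $\delta=\delta_{\mathbf{x}_*}$ is called the indicator of $\mathbf{x}_*$. *)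

theory Defs
  imports "HOL-Analysis.Analysis"
begin

definition eigenvalue :: "'a::field^'n^'n \<Rightarrow> 'a \<Rightarrow> bool" where
  "eigenvalue M l \<longleftrightarrow> (\<exists>v. v \<noteq> 0 \<and> M *v v = l *s v)"

definition eigenvector :: "'a::field^'n^'n \<Rightarrow> 'a^'n \<Rightarrow> bool" where
  "eigenvector M v \<longleftrightarrow> v \<noteq> 0 \<and> (\<exists>l. M *v v = l *s v)"

text \<open>Real matrices are complexified entrywise, so that non-real eigenvalues are included.\<close>

definition complex_spectrum :: "real^'n^'n \<Rightarrow> complex set" where
  "complex_spectrum M = {l. eigenvalue (map_matrix complex_of_real M) l}"

definition hurwitz :: "real^'n^'n \<Rightarrow> bool" where
  "hurwitz M \<longleftrightarrow> (\<forall>l \<in> complex_spectrum M. Re l < 0)"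

definition gradient :: "('a::real_inner \<Rightarrow> real) \<Rightarrow> 'a \<Rightarrow> 'a" where
  "gradient h x = (THE D. GDERIV h x :> D)"

lemma gradient_eq:
  assumes "GDERIV h x :> D"
  shows "gradient h x = D"
  unfolding gradient_def
proof (rule the_equality)
  fix D' assume "GDERIV h x :> D'"
  then have "(\<lambda>y. y \<bullet> D') = (\<lambda>y. y \<bullet> D)"
    using assms has_derivative_unique unfolding gderiv_def by blast
  then show "D' = D"
    by (metis vector_eq_ldot)
qed fact

text \<open>
  The closed-loop matrix \<open>A - BK\<close> obtained with the nominal controller \<open>u = -Kx\<close>.
\<close>

definition closed_loop_matrix :: "real^'n^'n \<Rightarrow> real^'m^'n \<Rightarrow> real^'n^'m \<Rightarrow> real^'n^'n" where
  "closed_loop_matrix A B K = A - B ** K"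

text \<open>
  In the following, \<open>M\<close> is always the closed-loop matrix, \<open>B\<close> the input matrix,
  \<open>G\<close> the state-dependent weight of the filter and \<open>{x. h x \<ge> 0}\<close> the safe set.
\<close>

definition safe_set :: "(real^'n \<Rightarrow> real) \<Rightarrow> (real^'n) set" where
  "safe_set h = {x. h x \<ge> 0}"

definition extended_class_K_inf :: "(real \<Rightarrow> real) \<Rightarrow> bool" where
  "extended_class_K_inf \<alpha> \<longleftrightarrow>
     continuous_on UNIV \<alpha> \<and> strict_mono \<alpha> \<and> \<alpha> 0 = 0 \<and>
     filterlim \<alpha> at_top at_top \<and> filterlim \<alpha> at_bot at_bot"

definition filter_eta ::
  "real^'n^'n \<Rightarrow> (real^'n \<Rightarrow> real) \<Rightarrow> (real \<Rightarrow> real) \<Rightarrow> real^'n \<Rightarrow> real" where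
  "filter_eta M h \<alpha> x = gradient h x \<bullet> (M *v x) + \<alpha> (h x)"

definition safety_filter ::
  "real^'n^'n \<Rightarrow> real^'m^'n \<Rightarrow> (real^'n \<Rightarrow> real^'m^'m) \<Rightarrow> (real^'n \<Rightarrow> real) \<Rightarrow> (real \<Rightarrow> real)
     \<Rightarrow> real^'n \<Rightarrow> real^'m" where
  "safety_filter M B G h \<alpha> x =
     (if filter_eta M h \<alpha> x \<ge> 0 then 0
      else - (filter_eta M h \<alpha> x
               / (gradient h x \<bullet> ((B ** matrix_inv (G x) ** transpose B) *v gradient h x)))
             *\<^sub>R ((matrix_inv (G x) ** transpose B) *v gradient h x))"

definition filtered_system ::
  "real^'n^'n \<Rightarrow> real^'m^'n \<Rightarrow> (real^'n \<Rightarrow> real^'m^'m) \<Rightarrow> (real^'n \<Rightarrow> real) \<Rightarrow> (real \<Rightarrow> real)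
     \<Rightarrow> real^'n \<Rightarrow> real^'n" where
  "filtered_system M B G h \<alpha> x = M *v x + B *v safety_filter M B G h \<alpha> x"

text \<open>
  The number \<open>\<delta>\<close> is unique unless \<open>B G(x)\<inverse> B\<^sup>T \<nabla>h(x) = 0\<close>.
\<close>

definition is_indicator ::
  "real^'n^'n \<Rightarrow> real^'m^'n \<Rightarrow> (real^'n \<Rightarrow> real^'m^'m) \<Rightarrow> (real^'n \<Rightarrow> real)
     \<Rightarrow> real^'n \<Rightarrow> real \<Rightarrow> bool" where
  "is_indicator M B G h x \<delta> \<longleftrightarrow>
     M *v x = \<delta> *\<^sub>R ((B ** matrix_inv (G x) ** transpose B) *v gradient h x)"

definition potential_undesired_equilibria ::
  "real^'n^'n \<Rightarrow> real^'m^'n \<Rightarrow> (real^'n \<Rightarrow> real^'m^'m) \<Rightarrow> (real^'n \<Rightarrow> real) \<Rightarrow> (real^'n) set" where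
  "potential_undesired_equilibria M B G h = {x. h x = 0 \<and> (\<exists>\<delta>. is_indicator M B G h x \<delta>)}"

definition undesired_equilibria ::
  "real^'n^'n \<Rightarrow> real^'m^'n \<Rightarrow> (real^'n \<Rightarrow> real^'m^'m) \<Rightarrow> (real^'n \<Rightarrow> real) \<Rightarrow> (real^'n) set" where
  "undesired_equilibria M B G h = {x. h x = 0 \<and> (\<exists>\<delta><0. is_indicator M B G h x \<delta>)}"

lemma hurwitz_kernel:
  fixes M :: "real^'n^'n"
  assumes "hurwitz M" and "M *v x = 0"
  shows "x = 0"
proof (rule ccontr)
  assume "x \<noteq> 0"
  define z :: "complex^'n" where "z = (\<chi> i. complex_of_real (x $ i))"
  have "z \<noteq> 0"
    using \<open>x \<noteq> 0\<close> by (auto simp: z_def vec_eq_iff)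
  moreover have "map_matrix complex_of_real M *v z = 0 *s z"
  proof (rule vec_eq_iff[THEN iffD2], rule allI)
    fix i
    have "(map_matrix complex_of_real M *v z) $ i = complex_of_real ((M *v x) $ i)"
      by (simp add: matrix_vector_mult_def z_def)
    then show "(map_matrix complex_of_real M *v z) $ i = (0 *s z) $ i"
      using assms(2) by simp
  qed
  ultimately have "0 \<in> complex_spectrum M"
    unfolding complex_spectrum_def eigenvalue_def by blast
  then show False
    using assms(1) by (force simp: hurwitz_def)
qed

text \<open>
  Whatever the choice of \<open>\<alpha>\<close>, the undesired equilibria are the equilibria of the filtered
  system in the safe set other than the origin.
\<close>

lemma undesired_equilibria_eq:
  fixes M :: "real^'n^'n" and B :: "real^'m^'n"
  assumes hur: "hurwitz M" and K: "extended_class_K_inf \<alpha>" and h0: "h 0 > 0"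
    and pos: "\<And>x u. u \<noteq> 0 \<Longrightarrow> u \<bullet> (G x *v u) > 0"
  shows "undesired_equilibria M B G h =
    {x \<in> safe_set h. filtered_system M B G h \<alpha> x = 0 \<and> x \<noteq> 0}"
proof (rule set_eqI)
  fix x
  define g where "g = gradient h x"
  define w where "w = (matrix_inv (G x) ** transpose B) *v g"
  define q where "q = g \<bullet> (B *v w)"
  define e where "e = filter_eta M h \<alpha> x"
  have a0: "\<alpha> 0 = 0" and mono: "strict_mono \<alpha>"
    using K by (auto simp: extended_class_K_inf_def)
  have Bw: "(B ** matrix_inv (G x) ** transpose B) *v g = B *v w"
    by (simp add: w_def matrix_vector_mul_assoc matrix_mul_assoc)
  have ind: "is_indicator M B G h x \<delta> \<longleftrightarrow> M *v x = \<delta> *\<^sub>R (B *v w)" for \<delta>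
    by (simp add: is_indicator_def Bw flip: g_def)
  have "safety_filter M B G h \<alpha> x = (if e \<ge> 0 then 0 else (- (e / q)) *\<^sub>R w)"
    unfolding safety_filter_def g_def[symmetric] e_def[symmetric] w_def[symmetric]
    by (simp add: Bw q_def)
  then have fs: "filtered_system M B G h \<alpha> x =
      M *v x + (if e \<ge> 0 then 0 else (- (e / q)) *\<^sub>R (B *v w))"
    unfolding filtered_system_def by (simp only: matrix_vector_mult_scaleR
        matrix_vector_mult_0_right if_distrib[of "(*v) B"])
  have e: "e = g \<bullet> (M *v x) + \<alpha> (h x)"
    by (simp add: e_def filter_eta_def g_def)
  have q: "q > 0" if "w \<noteq> 0"
  proof -
    have "inj ((*v) (G x))"
    proof (rule linear_injective_0[OF matrix_vector_mul_linear, THEN iffD2], intro allI impI)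
      fix u assume "G x *v u = 0"
      then show "u = 0" using pos[of u x] by force
    qed
    then have "invertible (G x)"
      using invertible_left_inverse matrix_left_invertible_injective by blast
    then have "G x ** matrix_inv (G x) = mat 1"
      unfolding invertible_def matrix_inv_def by (metis (mono_tags, lifting) someI_ex)
    then have Gw: "G x *v w = transpose B *v g"
      by (simp add: w_def matrix_vector_mul_assoc matrix_mul_assoc)
    have "q = w \<bullet> (transpose B *v g)"
      by (metis dot_lmul_matrix inner_commute q_def transpose_matrix_vector)
    also have "\<dots> > 0" using pos[OF that, of x] by (simp add: Gw)
    finally show ?thesis .
  qed
  show "x \<in> undesired_equilibria M B G h \<longleftrightarrow>
    x \<in> {x \<in> safe_set h. filtered_system M B G h \<alpha> x = 0 \<and> x \<noteq> 0}"
  proof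
    assume "x \<in> undesired_equilibria M B G h"
    then obtain \<delta> where hx: "h x = 0" and d: "\<delta> < 0" and Mx: "M *v x = \<delta> *\<^sub>R (B *v w)"
      by (auto simp: undesired_equilibria_def ind)
    have x0: "x \<noteq> 0" using hx h0 by auto
    then have "w \<noteq> 0" using Mx hurwitz_kernel[OF hur] by force
    then have q0: "q > 0" by (rule q)
    have e': "e = \<delta> * q" by (simp add: e Mx q_def hx a0)
    have "e < 0" using d q0 by (simp add: e' mult_neg_pos)
    moreover have "e / q = \<delta>" using q0 by (simp add: e')
    ultimately have "filtered_system M B G h \<alpha> x = 0" by (simp add: fs Mx)
    then show "x \<in> {x \<in> safe_set h. filtered_system M B G h \<alpha> x = 0 \<and> x \<noteq> 0}"
      using x0 hx by (simp add: safe_set_def)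
  next
    assume "x \<in> {x \<in> safe_set h. filtered_system M B G h \<alpha> x = 0 \<and> x \<noteq> 0}"
    then have f0: "filtered_system M B G h \<alpha> x = 0" and x0: "x \<noteq> 0"
      by auto
    have Mx0: "M *v x \<noteq> 0" using hurwitz_kernel[OF hur] x0 by blast
    then have e0: "e < 0" using f0 by (auto simp: fs split: if_splits)
    then have Mx: "M *v x = (e / q) *\<^sub>R (B *v w)"
      using f0 by (simp add: fs)
    then have "w \<noteq> 0" using Mx0 by auto
    then have q0: "q > 0" by (rule q)
    then have "g \<bullet> (M *v x) = e" by (simp add: Mx q_def)
    then have "\<alpha> (h x) = \<alpha> 0" using e a0 by simp
    then have "h x = 0" using mono strict_mono_eq by blast
    moreover have "e / q < 0" using e0 q0 by (simp add: divide_neg_pos)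
    ultimately show "x \<in> undesired_equilibria M B G h"
      using Mx by (auto simp: undesired_equilibria_def ind)
  qed
qed

end

theory Submission
  imports Defs "HOL-Computational_Algebra.Polynomial"
begin

text \<open>
  Since \<open>B G\<inverse> B\<^sup>T\<close> is the identity and \<open>\<nabla>h(x) = 2 (x - x\<^sub>c)\<close>, a potential undesired
  equilibrium with indicator \<open>\<delta> = s / 2\<close> is a point \<open>x = x\<^sub>c + y\<close> with \<open>\<bar>y\<bar> = r\<close> and
  \<open>(M - s) y = - M x\<^sub>c\<close>. Multiplying by the adjugate of \<open>M - s\<close> gives
  \<open>\<chi>(s) y = s M x\<^sub>c - (det M) x\<^sub>c\<close> with \<open>\<chi>\<close> the characteristic polynomial. As \<open>x\<^sub>c\<close> is not
  an eigenvector, the right-hand side never vanishes, so the equilibria correspond bijectively to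
  the real roots of the quartic \<open>F(s) = r\<^sup>2 \<chi>(s)\<^sup>2 - \<bar>s M x\<^sub>c - (det M) x\<^sub>c\<bar>\<^sup>2\<close>. Its leading
  coefficient is positive, \<open>F(0) < 0\<close> because \<open>r < \<bar>x\<^sub>c\<bar>\<close>, and \<open>F < 0\<close> at every real
  eigenvalue of \<open>M\<close>. Hence \<open>F\<close> has a positive root, between one and three negative roots, and a
  root below the smallest real eigenvalue.
\<close>

section \<open>Gradient of the barrier and the weight of the filter\<close>

lemma gradient_norm_diff_power2:
  fixes c :: "'a::real_inner"
  shows "gradient (\<lambda>x. (norm (x - c))\<^sup>2 - k) x = 2 *\<^sub>R (x - c)"
proof (rule gradient_eq)
  have "((\<lambda>x. (x - c) \<bullet> (x - c) - k) has_derivative (\<lambda>v. v \<bullet> (2 *\<^sub>R (x - c)))) (at x)"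
    by (auto intro!: derivative_eq_intros simp: inner_commute)
  then show "GDERIV (\<lambda>x. (norm (x - c))\<^sup>2 - k) x :> 2 *\<^sub>R (x - c)"
    by (simp add: gderiv_def power2_norm_eq_inner)
qed

text \<open>\<open>matrix_inv (transpose B ** B) ** transpose B\<close> is a left inverse of the
  square matrix \<open>B\<close>, hence also a right inverse.\<close>

lemma matrix_inv_gram:
  fixes B :: "real^'n^'n"
  assumes "invertible B"
  shows "B ** matrix_inv (transpose B ** B) ** transpose B = mat 1"
proof -
  have "invertible (transpose B ** B)"
    using assms by (simp add: invertible_mult transpose_invertible)
  then have "matrix_inv (transpose B ** B) ** (transpose B ** B) = mat 1"
    unfolding invertible_def matrix_inv_def by (metis (mono_tags, lifting) someI_ex)
  then have "(matrix_inv (transpose B ** B) ** transpose B) ** B = mat 1"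
    by (simp add: matrix_mul_assoc)
  then have "B ** (matrix_inv (transpose B ** B) ** transpose B) = mat 1"
    using matrix_left_right_inverse by blast
  then show ?thesis
    by (simp add: matrix_mul_assoc)
qed

section \<open>Real roots from sign changes\<close>

lemma poly_root_greater:
  fixes p :: "real poly"
  assumes "lead_coeff p > 0" and "poly p l < 0"
  shows "\<exists>s>l. poly p s = 0"
proof -
  obtain n where n: "\<And>x. x \<ge> n \<Longrightarrow> lead_coeff p \<le> poly p x"
    using poly_pinfty_gt_lc[OF assms(1)] by blast
  have "poly p (max n (l + 1)) > 0"
    using n[of "max n (l + 1)"] assms(1) by simp
  then show ?thesis
    using poly_IVT_pos[of l "max n (l + 1)" p] assms(2) by (metis less_add_one less_max_iff_disj)
qed

text \<open>The reflection s -> -s turns this into the previous lemma; even degree keeps the leading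
  coefficient positive.\<close>

lemma poly_root_less:
  fixes p :: "real poly"
  assumes "lead_coeff p > 0" and "even (degree p)" and "poly p l < 0"
  shows "\<exists>s<l. poly p s = 0"
proof -
  let ?q = "pcompose p [:0, -1:]"
  have "lead_coeff ?q > 0"
    using assms(1,2) by (simp add: lead_coeff_comp)
  moreover have "poly ?q (- l) < 0"
    using assms(3) by (simp add: poly_pcompose)
  ultimately obtain s where "s > - l" "poly ?q s = 0"
    using poly_root_greater by blast
  then show ?thesis
    by (intro exI[of _ "- s"]) (simp add: poly_pcompose)
qed

section \<open>Characteristic polynomial and resolvent in dimension two\<close>

text \<open>This is det(M - s). The ring is generic so that it applies both to a real matrix and to
  its complexification.\<close>

definition charpoly2 :: "'a::comm_ring_1^2^2 \<Rightarrow> 'a \<Rightarrow> 'a" where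
  "charpoly2 M s = s\<^sup>2 - trace M * s + det M"

lemma charpoly2_eigenvalue:
  fixes M :: "'a::field^2^2"
  assumes "eigenvalue M l"
  shows "charpoly2 M l = 0"
proof -
  obtain v where v: "v \<noteq> 0" "M *v v = l *s v"
    using assms by (auto simp: eigenvalue_def)
  have e: "M$1$1 * v$1 + M$1$2 * v$2 = l * v$1" "M$2$1 * v$1 + M$2$2 * v$2 = l * v$2"
    using v(2) by (simp_all add: vec_eq_iff forall_2 matrix_vector_mult_def sum_2)
  \<comment> \<open>Multiply (M - l) v = 0 by the adjugate of M - l.\<close>
  have "charpoly2 M l * v$1 = 0" "charpoly2 M l * v$2 = 0"
    unfolding charpoly2_def det_2 trace_def sum_2 using e by algebra+
  then show ?thesis
    using v(1) by (auto simp: vec_eq_iff forall_2)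
qed

lemma charpoly2_complex_spectrum:
  fixes M :: "real^2^2"
  assumes "complex_of_real l \<in> complex_spectrum M"
  shows "charpoly2 M l = 0"
proof -
  have "charpoly2 (map_matrix complex_of_real M) (complex_of_real l) = 0"
    using assms by (auto simp: complex_spectrum_def intro: charpoly2_eigenvalue)
  then have "complex_of_real (charpoly2 M l) = 0"
    by (simp add: charpoly2_def det_2 trace_def sum_2)
  then show ?thesis
    by simp
qed

text \<open>The assumption reads (M - s) y = - M u. The adjugate of M - s is (trace M - s) I - M,
  and by Cayley-Hamilton it sends - M u to s M u - (det M) u.\<close>

lemma charpoly2_resolvent:
  fixes M :: "real^2^2"
  assumes "M *v (u + y) = s *\<^sub>R y"
  shows "charpoly2 M s *\<^sub>R y = s *\<^sub>R (M *v u) - det M *\<^sub>R u"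
proof -
  have e: "M$1$1 * (u$1 + y$1) + M$1$2 * (u$2 + y$2) = s * y$1"
    "M$2$1 * (u$1 + y$1) + M$2$2 * (u$2 + y$2) = s * y$2"
    using assms by (simp_all add: vec_eq_iff forall_2 matrix_vector_mult_def sum_2)
  have "charpoly2 M s * y$1 = s * (M$1$1 * u$1 + M$1$2 * u$2) - det M * u$1"
    "charpoly2 M s * y$2 = s * (M$2$1 * u$1 + M$2$2 * u$2) - det M * u$2"
    unfolding charpoly2_def det_2 trace_def sum_2 using e by algebra+
  then show ?thesis
    by (simp add: vec_eq_iff forall_2 matrix_vector_mult_def sum_2)
qed

lemma charpoly2_resolvent_converse:
  fixes M :: "real^2^2"
  assumes "charpoly2 M s *\<^sub>R y = s *\<^sub>R (M *v u) - det M *\<^sub>R u" and "charpoly2 M s \<noteq> 0"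
  shows "M *v (u + y) = s *\<^sub>R y"
proof -
  let ?p = "charpoly2 M s"
  have e: "?p * y$1 = s * (M$1$1 * u$1 + M$1$2 * u$2) - det M * u$1"
    "?p * y$2 = s * (M$2$1 * u$1 + M$2$2 * u$2) - det M * u$2"
    using assms(1) by (simp_all add: vec_eq_iff forall_2 matrix_vector_mult_def sum_2)
  \<comment> \<open>After scaling by \<open>?p\<close>, substituting \<open>e\<close> for
    \<open>?p\<close> times y leaves an identity in u that is Cayley-Hamilton; \<open>?p\<close>
    cancels afterwards.\<close>
  have "?p * (M$1$1 * (u$1 + y$1) + M$1$2 * (u$2 + y$2)) = ?p * (s * y$1)"
    "?p * (M$2$1 * (u$1 + y$1) + M$2$2 * (u$2 + y$2)) = ?p * (s * y$2)"
    using e unfolding charpoly2_def det_2 trace_def sum_2 by algebra+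
  then show ?thesis
    using assms(2) by (simp add: vec_eq_iff forall_2 matrix_vector_mult_def sum_2)
qed

section \<open>The quartic and its correspondence with the equilibria\<close>

text \<open>The quartic F in expanded form, so that degree and leading coefficient can be read
  off.\<close>

definition indicator_poly :: "real^2^2 \<Rightarrow> real^2 \<Rightarrow> real \<Rightarrow> real poly" where
  "indicator_poly M u r =
    [:(r * det M)\<^sup>2 - (det M)\<^sup>2 * (u \<bullet> u),
      2 * det M * (u \<bullet> (M *v u)) - 2 * r\<^sup>2 * trace M * det M,
      r\<^sup>2 * ((trace M)\<^sup>2 + 2 * det M) - (M *v u) \<bullet> (M *v u),
      - 2 * r\<^sup>2 * trace M,
      r\<^sup>2:]"

lemma poly_indicator_poly:
  "poly (indicator_poly M u r) s =
    (r * charpoly2 M s)\<^sup>2 - (norm (s *\<^sub>R (M *v u) - det M *\<^sub>R u))\<^sup>2"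
  unfolding power2_norm_eq_inner indicator_poly_def charpoly2_def
  by (simp add: inner_diff_left inner_diff_right inner_commute power2_eq_square algebra_simps)

lemma degree_indicator_poly: "r \<noteq> 0 \<Longrightarrow> degree (indicator_poly M u r) = 4"
  by (simp add: indicator_poly_def)

lemma lead_coeff_indicator_poly: "r \<noteq> 0 \<Longrightarrow> lead_coeff (indicator_poly M u r) = r\<^sup>2"
  by (simp add: indicator_poly_def)

lemma not_eigenvector_combination:
  fixes M :: "real^'n^'n"
  assumes "\<not> eigenvector M u" and "u \<noteq> 0" and "d \<noteq> 0"
  shows "s *\<^sub>R (M *v u) - d *\<^sub>R u \<noteq> 0"
proof
  assume eq: "s *\<^sub>R (M *v u) - d *\<^sub>R u = 0"
  then have "s \<noteq> 0"
    using assms(2,3) by auto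
  have "M *v u = inverse s *\<^sub>R (s *\<^sub>R (M *v u))"
    using \<open>s \<noteq> 0\<close> by simp
  also have "\<dots> = (inverse s * d) *s u"
    using eq by (simp add: scalar_mult_eq_scaleR)
  finally show False
    using assms(1,2) by (auto simp: eigenvector_def)
qed

text \<open>The predicate \<open>P\<close> lets one bijection serve all roots and the negative ones.
  Division by zero in \<open>f\<close> does not matter: a common zero of F and
  \<open>charpoly2 M\<close> would contradict \<open>ne\<close>.\<close>

lemma bij_betw_indicator_poly_roots:
  fixes M :: "real^2^2"
  assumes r: "r > 0" and ne: "\<And>s. s *\<^sub>R (M *v u) - det M *\<^sub>R u \<noteq> 0"
  defines "f \<equiv> \<lambda>s. u + (1 / charpoly2 M s) *\<^sub>R (s *\<^sub>R (M *v u) - det M *\<^sub>R u)"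
  shows "bij_betw f {s. poly (indicator_poly M u r) s = 0 \<and> P s}
    {x. norm (x - u) = r \<and> (\<exists>s. P s \<and> M *v x = s *\<^sub>R (x - u))}" (is "bij_betw f ?S ?X")
    and "\<And>s. poly (indicator_poly M u r) s = 0 \<Longrightarrow>
      norm (f s - u) = r \<and> M *v f s = s *\<^sub>R (f s - u)"
proof -
  have root: "norm (f s - u) = r \<and> M *v f s = s *\<^sub>R (f s - u)"
    if "poly (indicator_poly M u r) s = 0" for s
  proof -
    let ?w = "s *\<^sub>R (M *v u) - det M *\<^sub>R u"
    have eq: "(r * charpoly2 M s)\<^sup>2 = (norm ?w)\<^sup>2"
      using that by (simp add: poly_indicator_poly)
    have p: "charpoly2 M s \<noteq> 0"
      using eq ne[of s] by auto
    have "norm ?w = r * \<bar>charpoly2 M s\<bar>"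
      by (rule power2_eq_imp_eq) (use eq r in \<open>simp_all add: power_mult_distrib\<close>)
    then have "norm (f s - u) = r"
      using p by (simp add: f_def)
    moreover have "M *v (u + (1 / charpoly2 M s) *\<^sub>R ?w) = s *\<^sub>R ((1 / charpoly2 M s) *\<^sub>R ?w)"
      using p by (intro charpoly2_resolvent_converse) simp_all
    ultimately show ?thesis
      by (simp add: f_def)
  qed
  then show "\<And>s. poly (indicator_poly M u r) s = 0 \<Longrightarrow>
      norm (f s - u) = r \<and> M *v f s = s *\<^sub>R (f s - u)" .
  show "bij_betw f ?S ?X"
  proof (rule bij_betw_imageI)
    show "inj_on f ?S"
    proof (rule inj_onI)
      fix s t assume "s \<in> ?S" "t \<in> ?S" and eq: "f s = f t"
      \<comment> \<open>A point on the circle determines its scalar, because f s - u has norm r >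
        0.\<close>
      then have "s *\<^sub>R (f s - u) = t *\<^sub>R (f s - u)" "f s - u \<noteq> 0"
        using root[of s] root[of t] r by auto
      then show "s = t"
        by simp
    qed
    show "f ` ?S = ?X"
    proof (intro subset_antisym subsetI)
      show "x \<in> ?X" if "x \<in> f ` ?S" for x
        using that root by blast
    next
      fix x assume "x \<in> ?X"
      then obtain s where x: "norm (x - u) = r" and s: "P s" "M *v x = s *\<^sub>R (x - u)"
        by blast
      have eq: "charpoly2 M s *\<^sub>R (x - u) = s *\<^sub>R (M *v u) - det M *\<^sub>R u"
        using s(2) by (intro charpoly2_resolvent) simp
      then have p: "charpoly2 M s \<noteq> 0"
        using ne[of s] by auto
      have "poly (indicator_poly M u r) s = 0"
        unfolding poly_indicator_poly eq[symmetric] by (simp add: x power_mult_distrib)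
      moreover have "f s = x"
        unfolding f_def eq[symmetric] using p by simp
      ultimately show "x \<in> f ` ?S"
        using s(1) by blast
    qed
  qed
qed

section \<open>Counting the equilibria by the signs of the roots\<close>

theorem proposition5p13:
  fixes A B K :: "real^2^2" and xc :: "real^2" and r :: real
  defines "M \<equiv> closed_loop_matrix A B K"
    and "G \<equiv> (\<lambda>x::real^2. transpose B ** B)"
    and "h \<equiv> (\<lambda>x. (norm (x - xc))\<^sup>2 - r\<^sup>2)"
  assumes "invertible B"
    and "hurwitz M"
    and "r > 0"
    and "h 0 > 0"
    and "\<not> eigenvector M xc"
  shows "1 \<le> card (undesired_equilibria M B G h) \<and> card (undesired_equilibria M B G h) \<le> 3 \<and>
    1 \<le> card (potential_undesired_equilibria M B G h - undesired_equilibria M B G h) \<and>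
    (\<forall>l1 l2 :: real.
       complex_spectrum M = {complex_of_real l1, complex_of_real l2} \<and> l1 \<le> l2 \<longrightarrow>
       (\<exists>x \<in> undesired_equilibria M B G h. \<exists>\<delta>. is_indicator M B G h x \<delta> \<and> \<delta> < l1 / 2))"
proof -
  let ?F = "indicator_poly M xc r"
  let ?f = "\<lambda>s. xc + (1 / charpoly2 M s) *\<^sub>R (s *\<^sub>R (M *v xc) - det M *\<^sub>R xc)"
  let ?U = "undesired_equilibria M B G h" and ?E = "potential_undesired_equilibria M B G h"
  have ind: "is_indicator M B G h x \<delta> \<longleftrightarrow> M *v x = (2 * \<delta>) *\<^sub>R (x - xc)" for x \<delta>
    by (simp add: is_indicator_def G_def h_def matrix_inv_gram[OF \<open>invertible B\<close>]
        gradient_norm_diff_power2 mult.commute)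
  have h0: "h x = 0 \<longleftrightarrow> norm (x - xc) = r" for x
    using \<open>r > 0\<close> by (simp add: h_def)
  have "r\<^sup>2 < (norm xc)\<^sup>2"
    using \<open>h 0 > 0\<close> by (simp add: h_def)
  then have xc: "xc \<noteq> 0"
    using \<open>r > 0\<close> by auto
  have "inj ((*v) M)"
    by (rule linear_injective_0[OF matrix_vector_mul_linear, THEN iffD2])
      (use hurwitz_kernel[OF \<open>hurwitz M\<close>] in blast)
  then have d: "det M \<noteq> 0"
    using invertible_det_nz invertible_left_inverse matrix_left_invertible_injective by blast
  have ne: "s *\<^sub>R (M *v xc) - det M *\<^sub>R xc \<noteq> 0" for s
    by (rule not_eigenvector_combination[OF \<open>\<not> eigenvector M xc\<close> xc d])
  have ind_ex: "(\<exists>\<delta>. P (2 * \<delta>)) \<longleftrightarrow> (\<exists>s. P s)" for P :: "real \<Rightarrow> bool"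
  proof
    assume "\<exists>s. P s"
    then obtain s where "P (2 * (s / 2))"
      by auto
    then show "\<exists>\<delta>. P (2 * \<delta>)" ..
  qed blast
  have U: "?U = {x. norm (x - xc) = r \<and> (\<exists>s. s < 0 \<and> M *v x = s *\<^sub>R (x - xc))}"
    unfolding undesired_equilibria_def ind h0
    using ind_ex[of "\<lambda>s. s < 0 \<and> M *v x = s *\<^sub>R (x - xc)" for x] by simp
  \<comment> \<open>The conjunct \<open>True\<close> plays the part of \<open>P\<close> in the
    bijection.\<close>
  have E: "?E = {x. norm (x - xc) = r \<and> (\<exists>s. True \<and> M *v x = s *\<^sub>R (x - xc))}"
    unfolding potential_undesired_equilibria_def ind h0
    using ind_ex[of "\<lambda>s. M *v x = s *\<^sub>R (x - xc)" for x] by simp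
  note bij = bij_betw_indicator_poly_roots(1)[OF \<open>r > 0\<close> ne]
    and root = bij_betw_indicator_poly_roots(2)[OF \<open>r > 0\<close> ne]
  have bijU: "bij_betw ?f {s. poly ?F s = 0 \<and> s < 0} ?U"
    unfolding U by (rule bij)
  have bijE: "bij_betw ?f {s. poly ?F s = 0 \<and> True} ?E"
    unfolding E by (rule bij)
  have lc: "lead_coeff ?F > 0" and deg: "degree ?F = 4"
    using \<open>r > 0\<close> lead_coeff_indicator_poly[of r M xc] degree_indicator_poly[of r M xc]
    by auto
  then have ev: "even (degree ?F)" and F0: "?F \<noteq> 0"
    by auto
  \<comment> \<open>F(0) factors as (det M)^2 (r^2 - |xc|^2).\<close>
  have neg0: "poly ?F 0 < 0"
    using \<open>r\<^sup>2 < (norm xc)\<^sup>2\<close> d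
    by (simp add: poly_indicator_poly charpoly2_def power_mult_distrib)
  obtain sp where sp: "sp > 0" "poly ?F sp = 0"
    using poly_root_greater[OF lc neg0] by blast
  obtain sm where sm: "sm < 0" "poly ?F sm = 0"
    using poly_root_less[OF lc ev neg0] by blast
  have fin: "finite {s. poly ?F s = 0}"
    using F0 by (rule poly_roots_finite)
  \<comment> \<open>The positive root \<open>sp\<close> makes the inclusion strict, which lowers the
    bound from four to three.\<close>
  have "card {s. poly ?F s = 0 \<and> s < 0} < card {s. poly ?F s = 0}"
    using sp less_asym by (intro psubset_card_mono[OF fin]) blast
  also have "\<dots> \<le> 4"
    using card_poly_roots_bound[OF F0] deg by simp
  finally have le: "card ?U \<le> 3"
    using bij_betw_same_card[OF bijU] by simp
  have finU: "finite ?U"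
    using bij_betw_finite[OF bijU] fin by simp
  have finE: "finite ?E"
    using bij_betw_finite[OF bijE] fin by simp
  have "?f sm \<in> ?U"
    using bij_betwE[OF bijU] sm by blast
  then have ge: "1 \<le> card ?U"
    using finU by (metis One_nat_def Suc_leI card_gt_0_iff empty_iff)
  \<comment> \<open>A negative indicator at this point would have to coincide with
    \<open>sp / 2\<close> by uniqueness of the scalar.\<close>
  have "?f sp \<notin> ?U"
  proof
    assume "?f sp \<in> ?U"
    then obtain t where t: "t < 0" "M *v ?f sp = t *\<^sub>R (?f sp - xc)"
      unfolding U by blast
    have "t *\<^sub>R (?f sp - xc) = sp *\<^sub>R (?f sp - xc)" and "?f sp - xc \<noteq> 0"
      using root[OF sp(2)] t(2) \<open>r > 0\<close> by (metis, metis less_irrefl norm_zero)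
    then have "t = sp"
      using scaleR_cancel_right by blast
    then show False
      using t(1) sp(1) by simp
  qed
  moreover have "?f sp \<in> ?E"
    using bij_betwE[OF bijE] sp by blast
  ultimately have "?E - ?U \<noteq> {}"
    by blast
  then have diff: "1 \<le> card (?E - ?U)"
    using finE by (metis One_nat_def Suc_leI card_gt_0_iff finite_Diff)
  have "\<exists>x\<in>?U. \<exists>\<delta>. is_indicator M B G h x \<delta> \<and> \<delta> < l1 / 2"
    if spec: "complex_of_real l1 \<in> complex_spectrum M" for l1
  proof -
    have "l1 < 0"
      using \<open>hurwitz M\<close> spec by (force simp: hurwitz_def)
    \<comment> \<open>At an eigenvalue the square of \<open>charpoly2\<close> drops out and only the
      negated squared norm remains.\<close>
    have "poly ?F l1 < 0"
      using ne[of l1] by (simp add: poly_indicator_poly charpoly2_complex_spectrum[OF spec])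
    then obtain s where s: "s < l1" "poly ?F s = 0"
      using poly_root_less[OF lc ev] by blast
    then have "?f s \<in> ?U"
      using bij_betwE[OF bijU] \<open>l1 < 0\<close> by simp
    moreover have "is_indicator M B G h (?f s) (s / 2)"
      unfolding ind using root[OF s(2)] by simp
    ultimately show ?thesis
      using s(1) by (intro bexI[of _ "?f s"] exI[of _ "s / 2"]) simp_all
  qed
  then show ?thesis
    using ge le diff by blast
qed

end
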